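(* Let $m\ge 0$, $l\ge 1$ and $n\ge 4$ be integers, let $r=\gcd(l,m)$, and let $c_m(\mathcal{K}_n(l))$ be the $m$-cone of the $l$-duplication of the complete graph $\mathcal{K}_n$ with $n$ vertices. Then \[ K(c_m(\mathcal{K}_n(l)))\cong\mathbb{Z}_r\oplus\mathbb{Z}_{m+nl}^{\,n-2}\oplus\mathbb{Z}_{m(m+nl)/r}. \]
   Context: For a simple graph $\mathcal{G}$ and an integer $l\ge 1$, the $l$-duplication $\mathcal{G}(l)$ is the multigraph obtained by replacing every edge of $\mathcal{G}$ by $l$ parallel edges. For a multigraph $\mathcal{H}$ and an integer $k\ge 0$, the $k$-cone $c_k(\mathcal{H})$ is the multigraph obtained by adding a new vertex $s$ (the sink) and $k$ parallel edges between $s$ and every vertex of $\mathcal{H}$. The Laplacian is $L=D-A$ ($D$ the diagonal degree matrix, $A$ the adjacency matrix counting edge multiplicities), and the reduced Laplacian $L(\cdot,s)$ is obtained by deleting the row and column of $s$. The critical group $K(c_k(\mathcal{H}))$ is the cokernel $\mathbb{Z}^{V(\mathcal{H})}/\mathrm{Im}\,L(c_k(\mathcal{H}),s)^t$, where $L(c_k(\mathcal{H}),s)=L(\mathcal{H})+kI$. $\mathbb{Z}_d=\mathbb{Z}/d\mathbb{Z}$, with $\mathbb{Z}_0=\mathbb{Z}$. *)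

theory Defs
  imports "HOL-Algebra.Algebra" "HOL-Library.Multiset"
begin

section \<open>Simple graphs and multigraphs\<close>

text \<open>Edges are unordered: an edge is the two-element set of its endpoints, and a multigraph
  (without loops) carries a multiset of such edges.\<close>

record 'a sgraph =
  sverts :: "'a set"
  sedges :: "'a set set"

record 'a mgraph =
  mverts :: "'a set"
  medges :: "'a set multiset"

definition simple_graph :: "'a sgraph \<Rightarrow> bool" where
  "simple_graph G \<longleftrightarrow> finite (sverts G) \<and> (\<forall>e\<in>sedges G. e \<subseteq> sverts G \<and> card e = 2)"

definition multigraph :: "'a mgraph \<Rightarrow> bool" where
  "multigraph H \<longleftrightarrow> finite (mverts H) \<and> (\<forall>e\<in>#medges H. e \<subseteq> mverts H \<and> card e = 2)"

definition complete_graph :: "nat \<Rightarrow> nat sgraph" where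
  "complete_graph n = \<lparr>sverts = {..<n}, sedges = {e. e \<subseteq> {..<n} \<and> card e = 2}\<rparr>"

definition duplication :: "nat \<Rightarrow> 'a sgraph \<Rightarrow> 'a mgraph" where
  "duplication l G = \<lparr>mverts = sverts G, medges = repeat_mset l (mset_set (sedges G))\<rparr>"

text \<open>Passing to the option type makes the sink new: it is the vertex \<^term>\<open>None\<close>, and an old
  vertex \<open>v\<close> becomes \<open>Some v\<close>.\<close>

definition graph_cone :: "nat \<Rightarrow> 'a mgraph \<Rightarrow> 'a option mgraph" where
  "graph_cone k H = \<lparr>mverts = insert None (Some ` mverts H),
     medges = image_mset (image Some) (medges H)
       + (\<Sum>v\<in>mverts H. replicate_mset k {None, Some v})\<rparr>"

section \<open>Laplacian and critical group\<close>

text \<open>Matrices indexed by vertices are binary functions; only their values on vertices matter.\<close>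

definition adjacency :: "'a mgraph \<Rightarrow> 'a \<Rightarrow> 'a \<Rightarrow> nat" where
  "adjacency H u v = count (medges H) {u, v}"

definition vertex_degree :: "'a mgraph \<Rightarrow> 'a \<Rightarrow> nat" where
  "vertex_degree H v = size {#e \<in># medges H. v \<in> e#}"

definition laplacian :: "'a mgraph \<Rightarrow> 'a \<Rightarrow> 'a \<Rightarrow> int" where
  "laplacian H u v = (if u = v then int (vertex_degree H u) else 0) - int (adjacency H u v)"

text \<open>\<open>\<int>\<^sup>W\<close> consists of the integer functions on \<open>W\<close>
  (with the value \<^term>\<open>undefined\<close> off \<open>W\<close>), under pointwise addition.\<close>

definition int_vectors :: "'a set \<Rightarrow> ('a \<Rightarrow> int) monoid" where
  "int_vectors W = product_group W (\<lambda>_. integer_group)"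

text \<open>The image of the transpose of the matrix \<open>M\<close> restricted to rows and columns in \<open>W\<close>.\<close>

definition transpose_image :: "'a set \<Rightarrow> ('a \<Rightarrow> 'a \<Rightarrow> int) \<Rightarrow> ('a \<Rightarrow> int) set" where
  "transpose_image W M =
     (\<lambda>x. \<lambda>u\<in>W. \<Sum>v\<in>W. M v u * x v) ` carrier (int_vectors W)"

text \<open>Restricting the Laplacian to the vertices other than \<open>s\<close> deletes the row and the
  column of \<open>s\<close>, so it gives the reduced Laplacian.\<close>

definition critical_group :: "'a mgraph \<Rightarrow> 'a \<Rightarrow> ('a \<Rightarrow> int) set monoid" where
  "critical_group H s =
     int_vectors (mverts H - {s}) Mod transpose_image (mverts H - {s}) (laplacian H)"

section \<open>Basic properties\<close>

lemma simple_graph_complete_graph: "simple_graph (complete_graph n)"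
  by (auto simp: simple_graph_def complete_graph_def)

lemma finite_sedges: "simple_graph G \<Longrightarrow> finite (sedges G)"
  by (rule finite_subset[of _ "Pow (sverts G)"]) (auto simp: simple_graph_def)

lemma multigraph_duplication:
  assumes "simple_graph G" shows "multigraph (duplication l G)"
  using assms finite_sedges[OF assms]
  by (auto simp: multigraph_def duplication_def simple_graph_def count_greater_zero_iff
        simp flip: count_greater_zero_iff)

lemma multigraph_cone:
  assumes "multigraph H" shows "multigraph (graph_cone k H)"
proof -
  have fin: "finite (mverts H)" using assms by (simp add: multigraph_def)
  have *: "set_mset (medges (graph_cone k H)) \<subseteq> image Some ` set_mset (medges H) \<union>
      (\<lambda>v. {None, Some v}) ` mverts H"
    using fin by (auto simp: graph_cone_def set_mset_sum in_replicate_mset)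
  have "e \<subseteq> mverts (graph_cone k H) \<and> card e = 2" if e: "e \<in># medges (graph_cone k H)" for e
  proof -
    consider f where "f \<in># medges H" "e = Some ` f" | v where "v \<in> mverts H" "e = {None, Some v}"
      using subsetD[OF * e] by blast
    then show ?thesis
      using assms by cases (auto simp: multigraph_def graph_cone_def card_image)
  qed
  then show ?thesis using fin by (auto simp: multigraph_def graph_cone_def)
qed

lemma adjacency_duplication_complete_graph:
  assumes "u < n" "v < n"
  shows "adjacency (duplication l (complete_graph n)) u v = (if u = v then 0 else l)"
proof -
  have "finite (sedges (complete_graph n))"
    by (rule finite_sedges[OF simple_graph_complete_graph])
  then show ?thesis
    using assms by (auto simp: adjacency_def duplication_def complete_graph_def count_mset_set')
qed

lemma reduced_laplacian_graph_cone:
  assumes "multigraph H" "u \<in> mverts H" "v \<in> mverts H"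
  shows "laplacian (graph_cone k H) (Some u) (Some v) = laplacian H u v + (if u = v then int k else 0)"
proof -
  have fin: "finite (mverts H)" using assms by (simp add: multigraph_def)
  have "count (image_mset (image Some) M) (Some ` e) = count M e" for M and e :: "'a set"
    by (induction M) (auto simp: inj_image_eq_iff)
  from this[of "medges H" "{u, v}"]
  have adj: "adjacency (graph_cone k H) (Some u) (Some v) = adjacency H u v"
    using fin by (auto simp: adjacency_def graph_cone_def count_sum doubleton_eq_iff)
  have rep: "filter_mset P (replicate_mset k e) = (if P e then replicate_mset k e else {#})"
    for P and e :: "'a option set"
    by (induction k) auto
  have "size (filter_mset (\<lambda>e. Some u \<in> e) (\<Sum>v\<in>A. replicate_mset k {None, Some v}))
      = (if u \<in> A then k else 0)" if "finite A" for A
    using that by (induction A) (auto simp: rep)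
  then have deg: "vertex_degree (graph_cone k H) (Some u) = vertex_degree H u + k"
    using fin assms by (simp add: vertex_degree_def graph_cone_def filter_mset_image_mset image_iff)
  show ?thesis using deg by (auto simp: laplacian_def adj)
qed

lemma comm_group_int_vectors: "comm_group (int_vectors W)"
  by (rule group.group_comm_groupI)
    (auto simp: int_vectors_def intro!: restrict_ext)

lemma normal_transpose_image:
  assumes "finite W" shows "transpose_image W M \<lhd> int_vectors W"
proof -
  interpret comm_group "int_vectors W" by (rule comm_group_int_vectors)
  have "group_hom (int_vectors W) (int_vectors W) (\<lambda>x. \<lambda>u\<in>W. \<Sum>v\<in>W. M v u * x v)"
    by unfold_locales
      (auto simp: hom_def int_vectors_def sum.distrib algebra_simps intro!: restrict_ext)
  then have "subgroup (transpose_image W M) (int_vectors W)"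
    unfolding transpose_image_def by (rule group_hom.img_is_subgroup)
  then show ?thesis by (rule subgroup_imp_normal)
qed

lemma group_critical_group:
  assumes "multigraph H" shows "group (critical_group H s)"
  unfolding critical_group_def
  by (rule normal.factorgroup_is_group, rule normal_transpose_image)
    (use assms in \<open>simp add: multigraph_def\<close>)

end

theory Submission
  imports Defs
begin

text \<open>The reduced Laplacian is \<open>a I - l J\<close>, where \<open>a = m + n l\<close> and \<open>J\<close> is the all-ones matrix.
  In the basis \<open>e\<^sub>i - e\<^sub>0\<close> (\<open>i \<ge> 2\<close>), \<open>D = \<Sum>\<^sub>i (e\<^sub>i - e\<^sub>0)\<close>, \<open>e\<^sub>0\<close> the relations of its
  cokernel become \<open>a (e\<^sub>i - e\<^sub>0) = 0\<close>, \<open>a D = 0\<close> and \<open>m e\<^sub>0 = l D\<close>. The coordinates of a vector \<open>x\<close> are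
  \<open>x\<^sub>i - x\<^sub>1\<close>, \<open>x\<^sub>1\<close> and \<open>q = \<Sum>\<^sub>i x\<^sub>i\<close>. Write \<open>l = r l'\<close>, \<open>m = r m'\<close> and
  \<open>u l' + v m' = 1\<close>. The unimodular change of coordinates from \<open>(x\<^sub>1, q)\<close> to
  \<open>(v q - u x\<^sub>1, m' x\<^sub>1 + l' q)\<close> maps the lattice of the last two relations, spanned by \<open>(a, 0)\<close>
  and \<open>(-l, m)\<close>, onto \<open>r \<int> \<times> (m a / r) \<int>\<close>.\<close>

section \<open>Entries of the reduced Laplacian\<close>

lemma vertex_degree_duplication_complete_graph:
  assumes "v < n"
  shows "vertex_degree (duplication l (complete_graph n)) v = l * (n - 1)"
proof -
  have fin: "finite (sedges (complete_graph n))"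
    by (rule finite_sedges[OF simple_graph_complete_graph])
  have "{e \<in> sedges (complete_graph n). v \<in> e} = (\<lambda>w. {v, w}) ` ({..<n} - {v})"
    using assms by (auto simp: complete_graph_def card_2_iff image_iff doubleton_eq_iff)
  moreover have "inj_on (\<lambda>w. {v, w}) ({..<n} - {v})"
    by (auto simp: inj_on_def doubleton_eq_iff)
  ultimately have "card {e \<in> sedges (complete_graph n). v \<in> e} = n - 1"
    using assms by (simp add: card_image)
  moreover have "size {#e \<in># repeat_mset l A. P e#} = l * size (filter_mset P A)"
    for A :: "nat set multiset" and P
    by (induction l) (auto simp: repeat_mset_Suc)
  ultimately show ?thesis
    using fin by (simp add: vertex_degree_def duplication_def filter_mset_mset_set)
qed

text \<open>The degree \<open>l * (n - 1)\<close> plus the \<open>m\<close> edges to the sink is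
  \<open>m + n * l - l\<close>, so the diagonal fits the pattern \<open>a I - l J\<close> as
  well.\<close>

lemma laplacian_cone_duplication_complete_graph:
  assumes "i < n" "j < n"
  shows "laplacian (graph_cone m (duplication l (complete_graph n))) (Some i) (Some j) =
    (if i = j then int (m + n * l) else 0) - int l"
proof -
  have "multigraph (duplication l (complete_graph n))"
    by (intro multigraph_duplication simple_graph_complete_graph)
  then have "laplacian (graph_cone m (duplication l (complete_graph n))) (Some i) (Some j) =
      laplacian (duplication l (complete_graph n)) i j + (if i = j then int m else 0)"
    using assms
    by (intro reduced_laplacian_graph_cone) (auto simp: duplication_def complete_graph_def)
  moreover have "int (l * (n - 1)) = int (n * l) - int l"
    using assms by (simp add: of_nat_diff algebra_simps)
  ultimately show ?thesis
    using assms
    by (simp add: laplacian_def adjacency_duplication_complete_graph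
        vertex_degree_duplication_complete_graph del: of_nat_mult)
qed

section \<open>Canonical residues\<close>

lemma mod_carrier_integer_mod_group:
  "k mod int n \<in> carrier (integer_mod_group n)"
  by (simp add: carrier_integer_mod_group)

text \<open>For \<open>n = 0\<close> the carrier consists of all integers and \<open>mod 0\<close>
  is the identity; the last factor is of this kind when \<open>m = 0\<close>.\<close>

lemma mod_eq_self_integer_mod_group:
  "k \<in> carrier (integer_mod_group n) \<Longrightarrow> k mod int n = k"
  by (auto simp: carrier_integer_mod_group split: if_splits)

section \<open>The image lattice in adapted coordinates\<close>

lemma sum_lessThan_split_first:
  fixes x :: "nat \<Rightarrow> int"
  assumes "0 < n"
  shows "(\<Sum>i<n. x i) = x 0 + (\<Sum>i\<in>{1..<n}. x i)"
proof -
  have "{..<n} = insert 0 {1..<n}" using assms by auto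
  then show ?thesis by simp
qed

text \<open>Let \<open>Y\<close> be the sum of \<open>y\<close>. Then \<open>q = r m' Y\<close> and
  \<open>x 1 = a y 1 - r l' Y\<close>, so by \<open>bez\<close> the two mixed coordinates are
  \<open>r Y - u a y 1\<close> and \<open>m' a y 1\<close>, where \<open>r\<close> divides
  \<open>a\<close>; moreover \<open>x i - x 1 = a (y i - y 1)\<close>. Conversely, \<open>y\<close>
  is rebuilt from the quotients of the divisibilities.\<close>

lemma image_scalar_minus_all_ones_iff:
  fixes l' m' u v r a :: int and n :: nat and x :: "nat \<Rightarrow> int"
  assumes bez: "u * l' + v * m' = 1" and n: "n \<ge> 2"
    and a: "a = r * m' + int n * (r * l')"
  defines "q \<equiv> \<Sum>i<n. x i"
  shows "(\<exists>y. \<forall>i<n. x i = a * y i - r * l' * (\<Sum>j<n. y j)) \<longleftrightarrow>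
    r dvd (v * q - u * x 1) \<and> (\<forall>i\<in>{2..<n}. a dvd (x i - x 1)) \<and>
    m' * a dvd (m' * x 1 + l' * q)"
    (is "?img \<longleftrightarrow> ?div")
proof
  assume ?img
  then obtain y where y: "\<And>i. i < n \<Longrightarrow> x i = a * y i - r * l' * (\<Sum>j<n. y j)"
    by blast
  define Y where "Y = (\<Sum>j<n. y j)"
  have x: "x i = a * y i - r * l' * Y" if "i < n" for i
    using y that by (simp add: Y_def)
  have "q = (\<Sum>i<n. a * y i - r * l' * Y)"
    unfolding q_def by (rule sum.cong) (auto simp: x)
  also have "\<dots> = a * Y - int n * (r * l' * Y)"
    by (simp add: sum_subtractf sum_distrib_left Y_def)
  finally have q: "q = r * m' * Y"
    by (simp add: a algebra_simps)
  have x1: "x 1 = a * y 1 - r * l' * Y" using x n by simp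
  have "v * q - u * x 1 = r * (v * m' * Y - u * ((m' + int n * l') * y 1 - l' * Y))"
    unfolding q x1 a by (simp add: algebra_simps)
  moreover have "x i - x 1 = a * (y i - y 1)" if "i \<in> {2..<n}" for i
    using that by (simp add: x x1 algebra_simps)
  moreover have "m' * x 1 + l' * q = m' * a * y 1"
    unfolding q x1 by (simp add: algebra_simps)
  ultimately show ?div by (metis dvd_triv_left)
next
  assume d: ?div
  then obtain s where s: "v * q - u * x 1 = r * s" by blast
  from d obtain t where t: "m' * x 1 + l' * q = m' * a * t" by blast
  have "\<forall>i\<in>{1..<n}. \<exists>k. x i = x 1 + a * k"
  proof
    fix i assume "i \<in> {1..<n}"
    then consider "i = 1" | "i \<in> {2..<n}" by fastforce
    then show "\<exists>k. x i = x 1 + a * k"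
    proof cases
      case 1
      then show ?thesis by (intro exI[of _ 0]) simp
    next
      case 2
      with d obtain k where "x i - x 1 = a * k" by blast
      then show ?thesis by (intro exI[of _ k]) simp
    qed
  qed
  then obtain k where k: "\<And>i. i \<in> {1..<n} \<Longrightarrow> x i = x 1 + a * k i" by metis
  \<comment> \<open>Inverting the unimodular change of coordinates recovers \<open>x 1\<close>, and
    below \<open>q\<close>, from \<open>s\<close> and \<open>t\<close>.\<close>
  have "(u * l' + v * m') * x 1 = v * (m' * x 1 + l' * q) - l' * (v * q - u * x 1)"
    by (simp add: algebra_simps)
  then have "x 1 = v * (m' * a * t) - l' * (r * s)" unfolding bez s t by simp
  also have "\<dots> = (u * l' + v * m') * a * t - r * l' * s - u * l' * a * t"
    by (simp add: algebra_simps)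
  finally have x1: "x 1 = a * t - l' * (r * s + u * a * t)"
    unfolding bez by (simp add: algebra_simps)
  have "(u * l' + v * m') * q = m' * (v * q - u * x 1) + u * (m' * x 1 + l' * q)"
    by (simp add: algebra_simps)
  then have q: "q = m' * (r * s + u * a * t)"
    unfolding bez s t by (simp add: algebra_simps)
  \<comment> \<open>The sum required of \<open>y\<close>: it solves
    \<open>r Y - u a t = r s\<close>, with \<open>t\<close> in the role of \<open>y 1\<close> and
    \<open>m' + n l'\<close> as the quotient of \<open>a\<close> by \<open>r\<close>.\<close>
  define Y where "Y = s + u * (m' + int n * l') * t"
  have rY: "r * s + u * a * t = r * Y" by (simp add: Y_def a algebra_simps)
  \<comment> \<open>The entries from index 1 on are forced up to multiples killed by
    \<open>a\<close>; the entry at 0 adjusts the total to \<open>Y\<close>.\<close>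
  define y where
    "y i = (if i = 0 then Y - (\<Sum>i\<in>{1..<n}. t + k i) else t + k i)" for i
  have "(\<Sum>i\<in>{1..<n}. y i) = (\<Sum>i\<in>{1..<n}. t + k i)"
    by (rule sum.cong) (auto simp: y_def)
  then have sumy: "(\<Sum>i<n. y i) = Y" and y0: "(\<Sum>i\<in>{1..<n}. y i) = Y - y 0"
    using n by (simp_all add: sum_lessThan_split_first y_def)
  have xi: "x i = a * y i - r * l' * Y" if "i \<in> {1..<n}" for i
    using that k[OF that] x1[unfolded rY] by (simp add: y_def algebra_simps)
  \<comment> \<open>The equation at index 0 follows from the others, because both sides have the
    same total \<open>q = r m' Y\<close> over all indices.\<close>
  have "(\<Sum>i\<in>{1..<n}. x i) = (\<Sum>i\<in>{1..<n}. a * y i - r * l' * Y)"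
    by (rule sum.cong) (auto simp: xi)
  also have "\<dots> = a * (Y - y 0) - (int n - 1) * (r * l' * Y)"
    using n unfolding sum_subtractf sum_distrib_left[symmetric] y0 by (simp add: of_nat_diff)
  finally have "x 0 = q - (a * (Y - y 0) - (int n - 1) * (r * l' * Y))"
    using n by (simp add: q_def sum_lessThan_split_first)
  also have "\<dots> = a * y 0 - r * l' * Y"
    unfolding q rY by (simp add: a algebra_simps)
  finally have x0: "x 0 = a * y 0 - r * l' * Y" .
  have "x i = a * y i - r * l' * (\<Sum>j<n. y j)" if "i < n" for i
    unfolding sumy using that x0 xi by (cases "i = 0") auto
  then show ?img by blast
qed

section \<open>The cokernel and the critical group\<close>

text \<open>First isomorphism theorem for the map \<open>\<phi>\<close> reducing each coordinate
  modulo its divisor: the coordinates are integrally invertible, so \<open>\<phi>\<close> is onto,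
  and the divisibility criterion identifies its kernel. The enumeration \<open>h\<close> transfers
  the criterion from indices to vertices.\<close>

lemma int_vectors_Mod_scalar_minus_all_ones:
  fixes l m n r :: nat and h :: "nat \<Rightarrow> 'a" and M :: "'a \<Rightarrow> 'a \<Rightarrow> int"
  assumes h: "bij_betw h {..<n} W" and n: "n \<ge> 2" and l: "l \<ge> 1" and r: "r = gcd l m"
    and M: "\<And>i j. i < n \<Longrightarrow> j < n \<Longrightarrow>
      M (h i) (h j) = (if i = j then int (m + n * l) else 0) - int l"
  shows "int_vectors W Mod transpose_image W M \<cong>
    (integer_mod_group r \<times>\<times> product_group {..<n - 2} (\<lambda>_. integer_mod_group (m + n * l)))
      \<times>\<times> integer_mod_group (m * (m + n * l) div r)"
    (is "_ \<cong> ?H")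
proof -
  define a where "a = m + n * l"
  define l' where "l' = l div r"
  define m' where "m' = m div r"
  have r0: "r > 0" using l r by simp
  have lr: "l = r * l'" and mr: "m = r * m'" by (simp_all add: l'_def m'_def r)
  have b: "m * a div r = m' * a" using r0 by (simp add: mr)
  have "coprime l' m'" using l unfolding l'_def m'_def r by (intro div_gcd_coprime) auto
  then obtain u v where bez: "u * int l' + v * int m' = 1"
    using bezout_int[of "int l'" "int m'"] by auto
  have a_eq: "int a = int r * int m' + int n * (int r * int l')" by (simp add: a_def lr mr)

  define Q where "Q x = (\<Sum>i<n. x (h i))" for x :: "'a \<Rightarrow> int"
  define f1 where "f1 x = v * Q x - u * x (h 1)" for x
  define f2 where "f2 x = int m' * x (h 1) + int l' * Q x" for x
  \<comment> \<open>The differences \<open>x i - x 1\<close> start at \<open>i = 2\<close>, hence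
    the shift from the index set \<open>{..<n - 2}\<close>.\<close>
  define \<phi> where "\<phi> x = ((f1 x mod int r, \<lambda>j\<in>{..<n-2}. (x (h (j + 2)) - x (h 1)) mod int a),
      f2 x mod int (m' * a))" for x
  have inj: "inj_on h {..<n}" and hW: "h ` {..<n} = W" using h by (auto simp: bij_betw_def)
  have hin: "i < n \<Longrightarrow> h i \<in> W" for i using hW by auto
  let ?G = "int_vectors W"
  let ?K = "(integer_mod_group r \<times>\<times> product_group {..<n - 2} (\<lambda>_. integer_mod_group a))
      \<times>\<times> integer_mod_group (m' * a)"
  have add: "f1 (x \<otimes>\<^bsub>?G\<^esub> y) = f1 x + f1 y" "f2 (x \<otimes>\<^bsub>?G\<^esub> y) = f2 x + f2 y"
    "\<And>i. i < n \<Longrightarrow> (x \<otimes>\<^bsub>?G\<^esub> y) (h i) = x (h i) + y (h i)" for x y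
    using n by (simp_all add: f1_def f2_def Q_def int_vectors_def hin sum.distrib algebra_simps)
  have hom: "\<phi> \<in> hom ?G ?K"
  proof (rule homI)
    show "\<phi> x \<in> carrier ?K" for x
      by (auto simp: \<phi>_def mod_carrier_integer_mod_group simp del: of_nat_mult)
    show "\<phi> (x \<otimes>\<^bsub>?G\<^esub> y) = \<phi> x \<otimes>\<^bsub>?K\<^esub> \<phi> y" for x y
    proof -
      have "(x \<otimes>\<^bsub>?G\<^esub> y) (h (j + 2)) - (x \<otimes>\<^bsub>?G\<^esub> y) (h 1) =
          (x (h (j + 2)) - x (h 1)) + (y (h (j + 2)) - y (h 1))" if "j < n - 2" for j
        using that n by (subst (1 2) add(3)) auto
      then show ?thesis
        unfolding \<phi>_def add(1,2)
        by (simp add: mod_add_eq fun_eq_iff restrict_def del: of_nat_mult)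
    qed
  qed
  have surj: "\<phi> ` carrier ?G = carrier ?K"
  proof
    show "\<phi> ` carrier ?G \<subseteq> carrier ?K" by (rule hom_carrier[OF hom])
    show "carrier ?K \<subseteq> \<phi> ` carrier ?G"
    proof
      fix z assume "z \<in> carrier ?K"
      then obtain \<alpha> \<beta> \<gamma> where z: "z = ((\<alpha>, \<beta>), \<gamma>)" and \<alpha>: "\<alpha> \<in> carrier (integer_mod_group r)"
        and \<beta>: "\<beta> \<in> ({..<n-2} \<rightarrow>\<^sub>E carrier (integer_mod_group a))"
        and \<gamma>: "\<gamma> \<in> carrier (integer_mod_group (m' * a))"
        by auto
      \<comment> \<open>\<open>p\<close> and \<open>q\<close> are the values of
        \<open>x (h 1)\<close> and \<open>Q x\<close> for which \<open>f1 x = \<alpha>\<close> and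
        \<open>f2 x = \<gamma>\<close>. The differences to \<open>p\<close> are then prescribed by
        \<open>\<beta>\<close>, and the entry at 0 makes the total \<open>q\<close>.\<close>
      define p where "p = v * \<gamma> - int l' * \<alpha>"
      define q where "q = int m' * \<alpha> + u * \<gamma>"
      define c where "c i = (if i = 1 then p else p + \<beta> (i - 2))" for i :: nat
      define c' where "c' i = (if i = 0 then q - (\<Sum>i\<in>{1..<n}. c i) else c i)" for i
      define x where "x = (\<lambda>w\<in>W. c' (inv_into {..<n} h w))"
      have xh: "x (h i) = c' i" if "i < n" for i
        using that inj hin by (simp add: x_def)
      have "(\<Sum>i\<in>{1..<n}. c' i) = (\<Sum>i\<in>{1..<n}. c i)"
        by (rule sum.cong) (auto simp: c'_def)
      then have Q: "Q x = q"
        using n by (simp add: Q_def xh sum_lessThan_split_first c'_def)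
      have x1: "x (h 1) = p" using n by (simp add: xh c'_def c_def)
      have "f1 x = (u * int l' + v * int m') * \<alpha>"
        unfolding f1_def Q x1 p_def q_def by (simp add: algebra_simps)
      moreover have "f2 x = (u * int l' + v * int m') * \<gamma>"
        unfolding f2_def Q x1 p_def q_def by (simp add: algebra_simps)
      ultimately have f: "f1 x = \<alpha>" "f2 x = \<gamma>" unfolding bez by simp_all
      have "(\<lambda>j\<in>{..<n-2}. (x (h (j + 2)) - x (h 1)) mod int a) = \<beta>"
      proof
        fix j show "(\<lambda>j\<in>{..<n-2}. (x (h (j + 2)) - x (h 1)) mod int a) j = \<beta> j"
        proof (cases "j < n - 2")
          case True
          then have "x (h (j + 2)) - x (h 1) = \<beta> j" by (simp only: x1) (simp add: xh c'_def c_def)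
          moreover have "\<beta> j mod int a = \<beta> j"
            using True \<beta> by (intro mod_eq_self_integer_mod_group) auto
          ultimately show ?thesis using True by simp
        next
          case False
          then show ?thesis using PiE_arb[OF \<beta>, of j] by simp
        qed
      qed
      then have "\<phi> x = z"
        unfolding \<phi>_def z f mod_eq_self_integer_mod_group[OF \<alpha>] mod_eq_self_integer_mod_group[OF \<gamma>]
        by (simp only:)
      moreover have "x \<in> carrier ?G" by (simp add: x_def int_vectors_def)
      ultimately show "z \<in> \<phi> ` carrier ?G" by blast
    qed
  qed
  have Mh: "(\<Sum>v\<in>W. M v (h i) * y v) = int a * y (h i) - int l * (\<Sum>j<n. y (h j))"
    if "i < n" for i y
  proof -
    have "(\<Sum>v\<in>W. M v (h i) * y v) = (\<Sum>j<n. M (h j) (h i) * y (h j))"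
      by (rule sum.reindex_bij_betw[OF h, symmetric])
    also have "\<dots> = (\<Sum>j<n. (if j = i then int a * y (h j) else 0) - int l * y (h j))"
      using that by (intro sum.cong) (auto simp: M a_def algebra_simps)
    also have "\<dots> = int a * y (h i) - int l * (\<Sum>j<n. y (h j))"
      using that by (simp add: sum_subtractf sum_distrib_left)
    finally show ?thesis .
  qed
  \<comment> \<open>Pulling vectors back along \<open>h\<close> gives the form of the criterion; off
    \<open>W\<close> both sides of the matrix equation are \<open>undefined\<close>.\<close>
  have img: "x \<in> transpose_image W M \<longleftrightarrow>
      (\<exists>y. \<forall>i<n. x (h i) = int a * y i - int r * int l' * (\<Sum>j<n. y j))"
    (is "_ \<longleftrightarrow> ?R") if x: "x \<in> carrier ?G" for x
  proof
    assume "x \<in> transpose_image W M"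
    then obtain y where "x = (\<lambda>u\<in>W. \<Sum>v\<in>W. M v u * y v)"
      by (auto simp: transpose_image_def)
    then have "x (h i) = int a * y (h i) - int r * int l' * (\<Sum>j<n. y (h j))" if "i < n" for i
      using that Mh[OF that, of y] by (simp add: hin lr)
    then show ?R by (intro exI[of _ "y \<circ> h"]) simp
  next
    assume ?R
    then obtain y where y: "\<And>i. i < n \<Longrightarrow>
        x (h i) = int a * y i - int r * int l' * (\<Sum>j<n. y j)" by blast
    define y' where "y' = (\<lambda>w\<in>W. y (inv_into {..<n} h w))"
    have y'h: "y' (h i) = y i" if "i < n" for i
      using that inj hin by (simp add: y'_def)
    have "x = (\<lambda>u\<in>W. \<Sum>v\<in>W. M v u * y' v)"
    proof
      fix w show "x w = (\<lambda>u\<in>W. \<Sum>v\<in>W. M v u * y' v) w"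
      proof (cases "w \<in> W")
        case True
        then obtain i where "i < n" "w = h i" using hW by auto
        then show ?thesis using y True Mh[of i y'] by (simp add: y'h lr)
      next
        case False
        then show ?thesis using x PiE_arb[of x W _ w] by (simp add: int_vectors_def)
      qed
    qed
    moreover have "y' \<in> carrier ?G" by (simp add: y'_def int_vectors_def)
    ultimately show "x \<in> transpose_image W M" unfolding transpose_image_def by blast
  qed
  have sub: "transpose_image W M \<subseteq> carrier ?G"
    by (auto simp: transpose_image_def int_vectors_def)
  have one: "\<phi> x = \<one>\<^bsub>?K\<^esub> \<longleftrightarrow> int r dvd f1 x \<and>
      (\<forall>i\<in>{2..<n}. int a dvd (x (h i) - x (h 1))) \<and> int m' * int a dvd f2 x" for x
  proof -
    have "(\<forall>i\<in>{2..<n}. int a dvd (x (h i) - x (h 1))) \<longleftrightarrow>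
        (\<forall>j<n-2. int a dvd (x (h (j + 2)) - x (h 1)))"
    proof (intro iffI ballI allI impI)
      fix i assume *: "\<forall>j<n-2. int a dvd (x (h (j + 2)) - x (h 1))" and i: "i \<in> {2..<n}"
      have "i - 2 < n - 2" and "i - 2 + 2 = i" using i by auto
      then show "int a dvd (x (h i) - x (h 1))" using * by metis
    qed auto
    then show ?thesis
      by (simp add: \<phi>_def fun_eq_iff restrict_def mod_eq_0_iff_dvd)
  qed
  have ker: "kernel ?G ?K \<phi> = transpose_image W M"
  proof -
    have "\<phi> x = \<one>\<^bsub>?K\<^esub> \<longleftrightarrow> x \<in> transpose_image W M" if "x \<in> carrier ?G" for x
      unfolding one img[OF that] image_scalar_minus_all_ones_iff[OF bez n a_eq] f1_def f2_def Q_def ..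
    then show ?thesis using sub by (auto simp: kernel_def)
  qed
  have "group ?K" by (intro DirProd_group product_group group_integer_mod_group)
  then interpret group_hom ?G ?K \<phi>
    using comm_group_int_vectors[of W] hom
    by (simp add: group_hom_def group_hom_axioms_def comm_group_def)
  show ?thesis
    using FactGroup_iso[OF surj] unfolding ker b[unfolded a_def] by (simp only: a_def)
qed

theorem corollary3p3:
  fixes m l n r :: nat
  assumes "l \<ge> 1" and "n \<ge> 4" and "r = gcd l m"
  shows "critical_group (graph_cone m (duplication l (complete_graph n))) None \<cong>
    (integer_mod_group r \<times>\<times> product_group {..<n - 2} (\<lambda>_. integer_mod_group (m + n * l)))
      \<times>\<times> integer_mod_group (m * (m + n * l) div r)"
proof -
  have "mverts (graph_cone m (duplication l (complete_graph n))) - {None} = Some ` {..<n}"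
    by (auto simp: graph_cone_def duplication_def complete_graph_def)
  \<comment> \<open>\<open>Some\<close> enumerates the vertices other than the sink and serves as
    \<open>h\<close>.\<close>
  moreover have "bij_betw Some {..<n} (Some ` {..<n})"
    by (simp add: bij_betw_def)
  ultimately show ?thesis
    unfolding critical_group_def
    using assms laplacian_cone_duplication_complete_graph[of _ n _ m l]
    by (simp only:) (rule int_vectors_Mod_scalar_minus_all_ones, auto)
qed

end
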